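(* Let $n\ge 1$, let $P$ be the Bergman projection of $L^2(B_n)$ onto $\mathbb{H}^2(B_n)$, and let $Y=\sum_{i=1}^n a_i\frac{\partial}{\partial\overline{z_i}}$, where $a_1,\dots,a_n\in\mathbb{C}$ are constants, not all zero. Then $[Y,P]$ is not continuous on $L^2(B_n)$; that is, there is no bounded linear operator on $L^2(B_n)$ which agrees with $YP-PY$ on $D$.
   Context: $B_n$ is the open unit ball of $\mathbb{C}^n$, $\mu$ is Lebesgue measure on $\mathbb{C}^n$ normalized so that $\mu(B_n)=1$, and $L^2(B_n)=L^2(B_n,d\mu)$ is the space of square-integrable complex-valued functions. $\mathbb{H}^2(B_n)$ (the Bergman space) is the closed subspace of holomorphic functions in $L^2(B_n)$. The Bergman projection $P:L^2(B_n)\to\mathbb{H}^2(B_n)$ is the orthogonal projection, given by $(Pf)(z)=\int_{B_n}\frac{f(w)}{(1-z\cdot\overline{w})^{n+1}}\,d\mu(w)$ with $z\cdot\overline{w}=\sum_{j=1}^n z_j\overline{w_j}$. $D$ denotes the space of all polynomials in $z_1,\dots,z_n,\overline{z_1},\dots,\overline{z_n}$ with complex coefficients, restricted to $B_n$; it is dense in $L^2(B_n)$ and invariant under $P$ and under the derivations considered, so commutators are well defined on $D$. $\frac{\partial}{\partial\overline{z_i}}$ is the conjugate Wirtinger derivative and $[Y,P]=YP-PY$. *)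

theory Defs
  imports "HOL-Analysis.Analysis"
begin

text \<open>
  \<open>\<complex>\<^sup>n\<close> is \<^typ>\<open>complex ^ 'n\<close> with \<open>n = CARD('n)\<close>, whose norm is the Hermitian one. A function on
  the unit ball is represented by a total function whose values outside the ball are irrelevant:
  none of the notions below depends on them. The measure lives on the ball only, so
  that measurability, integrals and \<open>AE\<close> refer to the ball.
\<close>

abbreviation unit_ball :: "(complex ^ 'n) set" where
  "unit_ball \<equiv> ball 0 1"

definition ball_measure :: "(complex ^ 'n) measure" where
  "ball_measure = uniform_measure (lebesgue_on unit_ball) unit_ball"

definition L2_ball :: "(complex ^ 'n \<Rightarrow> complex) set" where
  "L2_ball = {f \<in> borel_measurable ball_measure. integrable ball_measure (\<lambda>z. (cmod (f z))\<^sup>2)}"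

definition L2_inner :: "(complex ^ 'n \<Rightarrow> complex) \<Rightarrow> (complex ^ 'n \<Rightarrow> complex) \<Rightarrow> complex" where
  "L2_inner f g = (LINT z|ball_measure. f z * cnj (g z))"

definition L2_norm :: "(complex ^ 'n \<Rightarrow> complex) \<Rightarrow> real" where
  "L2_norm f = sqrt (LINT z|ball_measure. (cmod (f z))\<^sup>2)"

text \<open>
  Elements of \<open>L\<^sup>2\<close> are classes modulo equality almost everywhere. An operator is given on
  representatives; additivity together with the norm bound makes it respect equality almost
  everywhere, so it is the same thing as a bounded linear operator on the classes.
\<close>

definition bounded_L2_operator ::
    "((complex ^ 'n \<Rightarrow> complex) \<Rightarrow> (complex ^ 'n \<Rightarrow> complex)) \<Rightarrow> bool" where
  "bounded_L2_operator T \<longleftrightarrow>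
     (\<forall>f\<in>L2_ball. T f \<in> L2_ball) \<and>
     (\<forall>f\<in>L2_ball. \<forall>g\<in>L2_ball.
        AE z in ball_measure. T (\<lambda>w. f w + g w) z = T f z + T g z) \<and>
     (\<forall>c. \<forall>f\<in>L2_ball. AE z in ball_measure. T (\<lambda>w. c * f w) z = c * T f z) \<and>
     (\<exists>K. \<forall>f\<in>L2_ball. L2_norm (T f) \<le> K * L2_norm f)"

text \<open>Holomorphy in several variables: the Frechet derivative exists and is complex linear.\<close>

definition holomorphic_on_ball :: "(complex ^ 'n \<Rightarrow> complex) \<Rightarrow> bool" where
  "holomorphic_on_ball f \<longleftrightarrow>
     (\<forall>z\<in>unit_ball. \<exists>f'. (f has_derivative f') (at z) \<and> (\<forall>c v. f' (c *s v) = c * f' v))"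

definition bergman_space :: "(complex ^ 'n \<Rightarrow> complex) set" where
  "bergman_space = {f \<in> L2_ball. holomorphic_on_ball f}"

text \<open>
  The orthogonal projection of \<open>L\<^sup>2\<close> onto the Bergman space. As the value at \<open>f\<close> is required to be
  the holomorphic representative, it is determined everywhere on the ball.
\<close>

definition bergman_projection ::
    "((complex ^ 'n \<Rightarrow> complex) \<Rightarrow> (complex ^ 'n \<Rightarrow> complex)) \<Rightarrow> bool" where
  "bergman_projection P \<longleftrightarrow>
     (\<forall>f\<in>L2_ball. P f \<in> bergman_space \<and>
        (\<forall>h\<in>bergman_space. L2_inner (\<lambda>z. f z - P f z) h = 0))"

definition polynomials_on_ball :: "(complex ^ 'n \<Rightarrow> complex) set" where
  "polynomials_on_ball = {f. \<exists>(A :: (('n \<Rightarrow> nat) \<times> ('n \<Rightarrow> nat)) set) c. finite A \<and>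
     (\<forall>z\<in>unit_ball. f z =
        (\<Sum>(\<alpha>, \<beta>)\<in>A. c (\<alpha>, \<beta>) * (\<Prod>i\<in>UNIV. (z $ i) ^ \<alpha> i * cnj (z $ i) ^ \<beta> i)))}"

text \<open>With \<open>z\<^sub>i = x + \<i>y\<close>, the operator \<open>(\<partial>/\<partial>x + \<i> \<partial>/\<partial>y) / 2\<close>.\<close>

definition wirtinger_bar :: "'n \<Rightarrow> (complex ^ 'n \<Rightarrow> complex) \<Rightarrow> complex ^ 'n \<Rightarrow> complex" where
  "wirtinger_bar i f z =
     (vector_derivative (\<lambda>t::real. f (z + t *\<^sub>R axis i 1)) (at 0)
      + \<i> * vector_derivative (\<lambda>t::real. f (z + t *\<^sub>R axis i \<i>)) (at 0)) / 2"

definition antiholomorphic_derivation ::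
    "complex ^ 'n \<Rightarrow> (complex ^ 'n \<Rightarrow> complex) \<Rightarrow> complex ^ 'n \<Rightarrow> complex" where
  "antiholomorphic_derivation a f z = (\<Sum>i\<in>UNIV. a $ i * wirtinger_bar i f z)"

definition commutator ::
    "((complex ^ 'n \<Rightarrow> complex) \<Rightarrow> (complex ^ 'n \<Rightarrow> complex)) \<Rightarrow>
     ((complex ^ 'n \<Rightarrow> complex) \<Rightarrow> (complex ^ 'n \<Rightarrow> complex)) \<Rightarrow>
     (complex ^ 'n \<Rightarrow> complex) \<Rightarrow> (complex ^ 'n \<Rightarrow> complex)" where
  "commutator Y P f z = Y (P f) z - P (Y f) z"

end

theory Submission
  imports Defs "HOL-Probability.Probability_Measure"
begin

text \<open>
  Since \<open>P f\<close> is holomorphic, \<open>Y P f = 0\<close>, so \<open>[Y, P] f = - P Y f\<close>, and pairing with the constant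
  \<open>1\<close>, which lies in the Bergman space, gives \<open>\<integral> [Y, P] f = - \<integral> Y f\<close>. A bounded extension would thus
  force \<open>\<bar>\<integral> Y f\<bar> \<le> K \<parallel>f\<parallel>\<close> for every polynomial \<open>f\<close>. This fails for
  \<open>f z = cnj (\<Sum>\<^sub>i a\<^sub>i z\<^sub>i) \<bar>z\<bar>\<^sup>2\<^sup>m\<close>: as \<open>m\<close> grows, \<open>\<parallel>f\<parallel> \<rightarrow> 0\<close> by dominated convergence, while
  \<open>Y f \<ge> m \<bar>z\<bar>\<^sup>2\<^sup>m\<^sup>-\<^sup>2 \<bar>\<Sum>\<^sub>i a\<^sub>i z\<^sub>i\<bar>\<^sup>2\<close> has integral bounded away from zero, the boundary shell of width
  about \<open>1/m\<close> contributing a constant.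
\<close>

section \<open>Coordinate sums and closure properties of the polynomials\<close>

lemma sum_mult_axis:
  fixes a :: "complex ^ 'n"
  shows "(\<Sum>j\<in>UNIV. a $ j * axis i c $ j) = a $ i * c"
proof -
  have "(\<Sum>j\<in>UNIV. a $ j * axis i c $ j) = (\<Sum>j\<in>UNIV. if j = i then a $ i * c else 0)"
    by (rule sum.cong) (auto simp: axis_def)
  then show ?thesis by simp
qed

lemma sum_mult_cnj_self:
  fixes z :: "complex ^ 'n"
  shows "(\<Sum>i\<in>UNIV. z $ i * cnj (z $ i)) = of_real ((norm z)\<^sup>2)"
  by (simp add: norm_vec_def L2_set_def sum_nonneg complex_norm_square[symmetric])

lemma monomial_polynomial:
  fixes \<alpha> \<beta> :: "'n::finite \<Rightarrow> nat"
  shows "(\<lambda>z. c * (\<Prod>i\<in>UNIV. (z $ i) ^ \<alpha> i * cnj (z $ i) ^ \<beta> i)) \<in> polynomials_on_ball"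
  unfolding polynomials_on_ball_def
  by (auto intro!: exI[of _ "{(\<alpha>, \<beta>)}"] exI[of _ "\<lambda>_. c"])

lemma polynomial_add:
  assumes "f \<in> polynomials_on_ball" "g \<in> polynomials_on_ball"
  shows "(\<lambda>z. f z + g z) \<in> polynomials_on_ball"
proof -
  let ?m = "\<lambda>z p. \<Prod>i\<in>UNIV. (z $ i) ^ fst p i * cnj (z $ i) ^ snd p i"
  from assms obtain A c B d where A: "finite A" "\<forall>z\<in>unit_ball. f z = (\<Sum>p\<in>A. c p * ?m z p)"
    and B: "finite B" "\<forall>z\<in>unit_ball. g z = (\<Sum>p\<in>B. d p * ?m z p)"
    unfolding polynomials_on_ball_def by (auto simp: case_prod_unfold)
  \<comment> \<open>Both coefficient families are extended by zero to the union of their supports,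
    so exponents common to \<open>A\<close> and \<open>B\<close> have their coefficients
    added.\<close>
  define e where "e p = (if p \<in> A then c p else 0) + (if p \<in> B then d p else 0)" for p
  have "f z + g z = (\<Sum>p\<in>A\<union>B. e p * ?m z p)" if "z \<in> unit_ball" for z
  proof -
    have "(\<Sum>p\<in>A. c p * ?m z p) = (\<Sum>p\<in>A\<union>B. (if p \<in> A then c p else 0) * ?m z p)"
      using A(1) B(1) by (intro sum.mono_neutral_cong_left) auto
    moreover have "(\<Sum>p\<in>B. d p * ?m z p) = (\<Sum>p\<in>A\<union>B. (if p \<in> B then d p else 0) * ?m z p)"
      using A(1) B(1) by (intro sum.mono_neutral_cong_left) auto
    ultimately show ?thesis
      using A(2) B(2) that by (simp only: e_def distrib_right sum.distrib)
  qed
  then show ?thesis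
    unfolding polynomials_on_ball_def using A(1) B(1)
    by (auto simp: case_prod_unfold intro!: exI[of _ "A \<union> B"] exI[of _ e])
qed

lemma polynomial_sum:
  assumes "\<And>i. i \<in> I \<Longrightarrow> f i \<in> polynomials_on_ball"
  shows "(\<lambda>z. \<Sum>i\<in>I. f i z) \<in> polynomials_on_ball"
  using assms
proof (induction I rule: infinite_finite_induct)
  case (insert x I)
  then show ?case using polynomial_add[of "f x" "\<lambda>z. \<Sum>i\<in>I. f i z"] by simp
\<comment> \<open>Empty and infinite index sets both give the zero function, which is a monomial
  with coefficient 0.\<close>
qed (use monomial_polynomial[of 0] in auto)

lemma polynomial_mult:
  assumes "f \<in> polynomials_on_ball" "g \<in> polynomials_on_ball"
  shows "(\<lambda>z. f z * g z) \<in> polynomials_on_ball"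
proof -
  let ?m = "\<lambda>z p. \<Prod>i\<in>UNIV. (z $ i) ^ fst p i * cnj (z $ i) ^ snd p i"
  from assms obtain A c B d where A: "finite A" "\<forall>z\<in>unit_ball. f z = (\<Sum>p\<in>A. c p * ?m z p)"
    and B: "finite B" "\<forall>z\<in>unit_ball. g z = (\<Sum>p\<in>B. d p * ?m z p)"
    unfolding polynomials_on_ball_def by (auto simp: case_prod_unfold)
  \<comment> \<open>Distinct pairs \<open>(p, q)\<close> may produce the same exponents. Writing the
    product as a double sum of single monomials leaves collecting like terms to
    \<open>polynomial_sum\<close>.\<close>
  define h where "h z = (\<Sum>p\<in>A. \<Sum>q\<in>B. c p * d q *
     (\<Prod>i\<in>UNIV. (z $ i) ^ (fst p i + fst q i) * cnj (z $ i) ^ (snd p i + snd q i)))" for z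
  have "h \<in> polynomials_on_ball"
    unfolding h_def by (intro polynomial_sum monomial_polynomial)
  moreover have "f z * g z = h z" if "z \<in> unit_ball" for z
    using A(2) B(2) that
    by (auto simp: h_def sum_product power_add prod.distrib mult_ac intro!: sum.cong)
  ultimately show ?thesis
    unfolding polynomials_on_ball_def by simp
qed

lemma polynomial_const: "(\<lambda>z. c) \<in> polynomials_on_ball"
  using monomial_polynomial[of c "\<lambda>_. 0" "\<lambda>_. 0"] by simp

lemma polynomial_power:
  assumes "f \<in> polynomials_on_ball"
  shows "(\<lambda>z. f z ^ k) \<in> polynomials_on_ball"
  by (induction k) (auto intro: polynomial_const polynomial_mult assms)

lemma polynomial_coord:
  fixes i :: "'n::finite"
  shows "(\<lambda>z. z $ i) \<in> polynomials_on_ball"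
proof -
  have "(\<Prod>j\<in>UNIV. (z $ j) ^ (if j = i then 1 else 0)) = (\<Prod>j\<in>UNIV. if j = i then z $ i else 1)"
    for z :: "complex ^ 'n" by (rule prod.cong) auto
  then show ?thesis
    using monomial_polynomial[of 1 "\<lambda>j. if j = i then 1 else 0" "\<lambda>_. 0"] by simp
qed

lemma polynomial_cnj_coord:
  fixes i :: "'n::finite"
  shows "(\<lambda>z. cnj (z $ i)) \<in> polynomials_on_ball"
proof -
  have "(\<Prod>j\<in>UNIV. cnj (z $ j) ^ (if j = i then 1 else 0)) = (\<Prod>j\<in>UNIV. if j = i then cnj (z $ i) else 1)"
    for z :: "complex ^ 'n" by (rule prod.cong) auto
  then show ?thesis
    using monomial_polynomial[of 1 "\<lambda>_. 0" "\<lambda>j. if j = i then 1 else 0"] by simp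
qed

section \<open>Wirtinger derivatives computed from the Frechet derivative\<close>

lemma vector_derivative_line:
  assumes "(f has_derivative f') (at z)"
  shows "vector_derivative (\<lambda>t::real. f (z + t *\<^sub>R v)) (at 0) = f' v"
proof -
  have "((\<lambda>t::real. z + t *\<^sub>R v) has_vector_derivative v) (at 0)"
    by (auto intro!: derivative_eq_intros)
  from vector_derivative_diff_chain_within[OF this, of f f'] assms
  show ?thesis
    by (intro vector_derivative_at) (auto simp: o_def intro: has_derivative_at_withinI)
qed

lemma wirtinger_bar_has_derivative:
  assumes "(f has_derivative f') (at z)"
  shows "wirtinger_bar i f z = (f' (axis i 1) + \<i> * f' (axis i \<i>)) / 2"
  unfolding wirtinger_bar_def using assms by (simp add: vector_derivative_line)

text \<open>These are the Cauchy-Riemann equations: complex linearity of \<open>f'\<close> turns the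
  derivative along \<open>axis i \<i>\<close> into \<i> times the one along \<open>axis i 1\<close>,
  and 1 + \<i> * \<i> = 0.\<close>

lemma antiholomorphic_derivation_holomorphic:
  assumes "holomorphic_on_ball f" "z \<in> unit_ball"
  shows "antiholomorphic_derivation a f z = 0"
proof -
  obtain f' where d: "(f has_derivative f') (at z)" and lin: "\<And>c v. f' (c *s v) = c * f' v"
    using assms unfolding holomorphic_on_ball_def by blast
  have "f' (axis i \<i>) = \<i> * f' (axis i 1)" for i
    using lin[of \<i> "axis i 1"] by (simp add: vector_scalar_mult_def axis_def if_distrib cong: if_cong)
  then have "wirtinger_bar i f z = 0" for i
    unfolding wirtinger_bar_has_derivative[OF d] by (simp add: algebra_simps)
  then show ?thesis by (simp add: antiholomorphic_derivation_def)
qed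

section \<open>The test functions and their derivatives\<close>

text \<open>The second factor is a power of the squared norm, spelled out in coordinates so that the
  polynomial closure rules apply directly.\<close>

definition testfun :: "complex ^ 'n \<Rightarrow> nat \<Rightarrow> complex ^ 'n \<Rightarrow> complex" where
  "testfun a m z = (\<Sum>i\<in>UNIV. cnj (a $ i) * cnj (z $ i)) * (\<Sum>i\<in>UNIV. z $ i * cnj (z $ i)) ^ m"

lemma testfun_polynomial: "testfun a m \<in> polynomials_on_ball"
  unfolding testfun_def
  by (intro polynomial_mult polynomial_power polynomial_sum polynomial_const polynomial_coord
      polynomial_cnj_coord)

lemma cmod_testfun: "cmod (testfun a m z) = cmod (\<Sum>i\<in>UNIV. a $ i * z $ i) * ((norm z)\<^sup>2) ^ m"
proof -
  have "(\<Sum>i\<in>UNIV. cnj (a $ i) * cnj (z $ i)) = cnj (\<Sum>i\<in>UNIV. a $ i * z $ i)" by simp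
  then show ?thesis
    by (simp only: testfun_def sum_mult_cnj_self norm_mult complex_mod_cnj norm_power norm_of_real) simp
qed

text \<open>Product rule, with s the sum of the \<open>a $ i * z $ i\<close>: the derivation sends
  the conjugate of s to \<open>(norm a)\<^sup>2\<close> and the squared norm of z to s. Both
  resulting terms are nonnegative reals, so no cancellation can occur in the integral. The exponent
  \<open>Suc k\<close> avoids a subtraction in the power rule.\<close>

lemma antiholomorphic_derivation_testfun:
  "antiholomorphic_derivation a (testfun a (Suc k)) z =
     of_real ((norm a)\<^sup>2 * ((norm z)\<^sup>2) ^ Suc k +
       Suc k * ((norm z)\<^sup>2) ^ k * (cmod (\<Sum>i\<in>UNIV. a $ i * z $ i))\<^sup>2)"
proof -
  let ?q = "of_real ((norm z)\<^sup>2) :: complex"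
  let ?s = "\<Sum>i\<in>UNIV. a $ i * z $ i"
  \<comment> \<open>\<open>q'\<close> is the real-linear differential of the squared norm at z, and
    \<open>f'\<close> that of the test function.\<close>
  define q' where "q' h = (\<Sum>i\<in>UNIV. z $ i * cnj (h $ i) + h $ i * cnj (z $ i))" for h :: "complex ^ 'a"
  define f' where "f' h = cnj ?s * (of_nat (Suc k) * ?q ^ k * q' h) +
      (\<Sum>i\<in>UNIV. cnj (a $ i) * cnj (h $ i)) * ?q ^ Suc k" for h :: "complex ^ 'a"
  have q: "((\<lambda>z. \<Sum>i\<in>UNIV. z $ i * cnj (z $ i)) has_derivative q') (at z)"
    unfolding q'_def
    by (auto intro!: derivative_eq_intros bounded_linear.has_derivative[OF bounded_linear_vec_nth]
        bounded_linear.has_derivative[OF bounded_linear_cnj])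
  have s: "((\<lambda>z. \<Sum>i\<in>UNIV. cnj (a $ i) * cnj (z $ i)) has_derivative
      (\<lambda>h. \<Sum>i\<in>UNIV. cnj (a $ i) * cnj (h $ i))) (at z)"
    by (auto intro!: derivative_eq_intros bounded_linear.has_derivative[OF bounded_linear_vec_nth]
        bounded_linear.has_derivative[OF bounded_linear_cnj])
  have d: "(testfun a (Suc k) has_derivative f') (at z)"
    unfolding testfun_def
    by (rule derivative_eq_intros s q refl)+
      (simp add: fun_eq_iff f'_def sum_mult_cnj_self mult_ac)
  have q': "q' (axis i c) = z $ i * cnj c + c * cnj (z $ i)" for i c
  proof -
    have "q' (axis i c) = (\<Sum>j\<in>UNIV. if j = i then z $ i * cnj c + c * cnj (z $ i) else 0)"
      unfolding q'_def by (rule sum.cong) (auto simp: axis_def)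
    then show ?thesis by simp
  qed
  have s': "(\<Sum>j\<in>UNIV. cnj (a $ j) * cnj (axis i c $ j)) = cnj (a $ i) * cnj c" for i c
    using arg_cong[OF sum_mult_axis[of a i c], of cnj] by simp
  \<comment> \<open>In \<open>q' (axis i 1) + \<i> * q' (axis i \<i>)\<close> the terms with
    \<open>cnj (z $ i)\<close> cancel and those with \<open>z $ i\<close> double, which absorbs the
    division by 2.\<close>
  have "wirtinger_bar i (testfun a (Suc k)) z
      = cnj ?s * (of_nat (Suc k) * ?q ^ k * z $ i) + cnj (a $ i) * ?q ^ Suc k" for i
    unfolding wirtinger_bar_has_derivative[OF d] f'_def q' s'
    by (simp add: field_simps)
  then have "antiholomorphic_derivation a (testfun a (Suc k)) z =
     cnj ?s * of_nat (Suc k) * ?q ^ k * ?s + (\<Sum>i\<in>UNIV. a $ i * cnj (a $ i)) * ?q ^ Suc k"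
    unfolding antiholomorphic_derivation_def
    by (simp only: distrib_left sum.distrib sum_distrib_left sum_distrib_right mult_ac)
  also have "\<dots> = of_real ((norm a)\<^sup>2 * ((norm z)\<^sup>2) ^ Suc k +
       Suc k * ((norm z)\<^sup>2) ^ k * (cmod ?s)\<^sup>2)"
    unfolding sum_mult_cnj_self of_real_add of_real_mult complex_norm_square[of ?s]
    by (simp add: algebra_simps)
  finally show ?thesis .
qed

section \<open>The normalized measure, integrability and volumes on the ball\<close>

lemma space_ball_measure [simp]: "space ball_measure = unit_ball"
  by (simp add: ball_measure_def space_restrict_space)

lemma sets_ball_measure: "sets ball_measure = sets (lebesgue_on unit_ball)"
  by (simp add: ball_measure_def)

text \<open>The ball is open, nonempty and bounded, so its Lebesgue measure is positive and finite.
  Total mass 1 makes bounded measurable functions integrable and gives access to the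
  variance.\<close>

interpretation ball: prob_space "ball_measure :: (complex ^ 'n) measure"
  unfolding ball_measure_def
proof (rule prob_space_uniform_measure)
  have "emeasure lebesgue (unit_ball :: (complex ^ 'n) set) \<noteq> 0"
    using open_not_negligible[of "unit_ball :: (complex ^ 'n) set"] negligible_iff_emeasure0
    by (metis centre_in_ball empty_iff lmeasurable_ball fmeasurableD open_ball zero_less_one)
  then show "emeasure (lebesgue_on (unit_ball :: (complex ^ 'n) set)) unit_ball \<noteq> 0"
    by (simp add: emeasure_restrict_space)
  show "emeasure (lebesgue_on (unit_ball :: (complex ^ 'n) set)) unit_ball \<noteq> \<infinity>"
    using lmeasurable_ball[of "0 :: complex ^ 'n" 1]
    by (auto simp: emeasure_restrict_space fmeasurable_def)
qed

lemma measure_unit_ball_pos: "0 < measure lebesgue (unit_ball :: (complex ^ 'n) set)"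
  using open_not_negligible[of "unit_ball :: (complex ^ 'n) set"] 
  by (simp add: negligible_iff_measure zero_less_measure_iff)

lemma measure_ball_measure:
  fixes A :: "(complex ^ 'n) set"
  assumes "A \<in> sets lebesgue" "A \<subseteq> unit_ball"
  shows "measure ball_measure A = measure lebesgue A / measure lebesgue (unit_ball :: (complex ^ 'n) set)"
proof -
  have b: "(unit_ball :: (complex ^ 'n) set) \<in> lmeasurable" by simp
  have e: "emeasure (lebesgue_on (unit_ball :: (complex ^ 'n) set)) unit_ball
      = ennreal (measure lebesgue (unit_ball :: (complex ^ 'n) set))"
    by (simp add: emeasure_restrict_space emeasure_eq_measure2[OF b])
  have "A \<in> sets (lebesgue_on unit_ball)"
    using assms by (simp add: sets_restrict_space_iff)
  then show ?thesis
    using e measure_unit_ball_pos[where 'n='n] assms unfolding ball_measure_def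
    by (subst measure_uniform_measure) (auto simp: measure_restrict_space Int_absorb1)
qed

lemma continuous_measurable_ball:
  assumes "continuous_on unit_ball f"
  shows "f \<in> borel_measurable ball_measure"
  using continuous_imp_measurable_on_sets_lebesgue[OF assms] sets_ball_measure
    measurable_cong_sets[OF sets_ball_measure refl] by auto

lemma bounded_integrable_ball:
  fixes f :: "complex ^ 'n \<Rightarrow> 'b::{banach, second_countable_topology}"
  assumes "continuous_on unit_ball f" "\<And>z. z \<in> unit_ball \<Longrightarrow> norm (f z) \<le> B"
  shows "integrable ball_measure f"
  using assms continuous_measurable_ball
  by (intro ball.integrable_const_bound[of _ B] AE_I2) auto

lemma continuous_bounded_L2:
  assumes "continuous_on unit_ball f" "\<And>z. z \<in> unit_ball \<Longrightarrow> cmod (f z) \<le> B"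
  shows "f \<in> L2_ball"
  unfolding L2_ball_def
  using assms
  by (auto intro!: continuous_measurable_ball bounded_integrable_ball[where B = "B\<^sup>2"]
      continuous_intros power_mono)

lemma L2_integrable:
  assumes "f \<in> L2_ball"
  shows "integrable ball_measure f"
proof -
  have m: "f \<in> borel_measurable ball_measure" and i: "integrable ball_measure (\<lambda>z. (cmod (f z))\<^sup>2)"
    using assms by (auto simp: L2_ball_def)
  have "integrable ball_measure (\<lambda>z. cmod (f z))"
    by (rule ball.square_integrable_imp_integrable) (use m i in auto)
  then show ?thesis using m by (simp add: integrable_norm_iff)
qed

text \<open>This is Cauchy-Schwarz against the constant 1, obtained from the nonnegativity of the
  variance of \<open>cmod (f z)\<close>.\<close>

lemma norm_integral_le_L2_norm:
  assumes "f \<in> L2_ball"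
  shows "cmod (LINT z|ball_measure. f z) \<le> L2_norm f"
proof -
  have i: "integrable ball_measure (\<lambda>z. (cmod (f z))\<^sup>2)"
    using assms by (auto simp: L2_ball_def)
  have "(LINT z|ball_measure. cmod (f z))\<^sup>2 \<le> (LINT z|ball_measure. (cmod (f z))\<^sup>2)"
    using ball.variance_positive[of "\<lambda>z. cmod (f z)"]
      ball.variance_eq[OF integrable_norm[OF L2_integrable[OF assms]] i] by simp
  then have "(LINT z|ball_measure. cmod (f z)) \<le> L2_norm f"
    unfolding L2_norm_def by (rule real_le_rsqrt)
  then show ?thesis
    using integral_norm_bound[of ball_measure f] by linarith
qed

text \<open>Dilation by r maps the part of the cone in the unit ball onto its part in
  \<open>ball 0 r\<close>, and scales Lebesgue measure by r to the power of the real
  dimension.\<close>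

lemma measure_cone_diff_ball:
  fixes C :: "'a::euclidean_space set"
  assumes C: "C \<in> sets lebesgue" and cone: "\<And>t x. 0 < t \<Longrightarrow> x \<in> C \<Longrightarrow> t *\<^sub>R x \<in> C"
    and r: "0 < r" "r \<le> 1"
  shows "measure lebesgue (C \<inter> ball 0 1 - ball 0 r) =
    (1 - r ^ DIM('a)) * measure lebesgue (C \<inter> ball 0 1)"
proof -
  have m: "C \<inter> ball 0 1 \<in> lmeasurable"
    using C fmeasurable_Int_fmeasurable[of "ball 0 1" lebesgue C] by (simp add: Int_commute)
  have "(\<lambda>x. r *\<^sub>R x + 0) ` (C \<inter> ball 0 1) = (C \<inter> ball 0 1) \<inter> ball 0 r"
  proof (intro set_eqI iffI)
    fix x assume "x \<in> (C \<inter> ball 0 1) \<inter> ball 0 r"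
    then have "inverse r *\<^sub>R x \<in> C \<inter> ball 0 1" "x = r *\<^sub>R (inverse r *\<^sub>R x) + 0"
      using r cone[of "inverse r" x] by (auto simp: field_simps)
    then show "x \<in> (\<lambda>x. r *\<^sub>R x + 0) ` (C \<inter> ball 0 1)" by blast
  next
    fix x assume "x \<in> (\<lambda>x. r *\<^sub>R x + 0) ` (C \<inter> ball 0 1)"
    then obtain y where y: "y \<in> C" "norm y < 1" "x = r *\<^sub>R y" by auto
    then have "norm x < r" using r by simp
    then show "x \<in> (C \<inter> ball 0 1) \<inter> ball 0 r"
      using y r cone[of r y] order_less_le_trans[of "norm x" r 1] by auto
  qed
  then have "measure lebesgue ((C \<inter> ball 0 1) \<inter> ball 0 r) = r ^ DIM('a) * measure lebesgue (C \<inter> ball 0 1)"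
    using measure_lebesgue_affine[of r 0 "C \<inter> ball 0 1"] r by simp
  moreover have "measure lebesgue (C \<inter> ball 0 1 - ball 0 r) =
     measure lebesgue (C \<inter> ball 0 1) - measure lebesgue ((C \<inter> ball 0 1) \<inter> ball 0 r)"
    using measurable_measure_Diff[OF m, of "(C \<inter> ball 0 1) \<inter> ball 0 r"]
      sets.Int[OF fmeasurableD[OF m], of "ball 0 r"]
    by (simp add: Diff_Int Int_lower1 le_infI1)
  ultimately show ?thesis by (simp add: algebra_simps)
qed

section \<open>Upper and lower estimates for the test functions\<close>

lemma cmod_sum_mult_le:
  fixes a z :: "complex ^ 'n"
  assumes "z \<in> unit_ball"
  shows "cmod (\<Sum>i\<in>UNIV. a $ i * z $ i) \<le> (\<Sum>i\<in>UNIV. cmod (a $ i))"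
proof (rule order_trans[OF norm_sum sum_mono])
  fix i
  have "cmod (z $ i) \<le> 1"
    using Finite_Cartesian_Product.norm_nth_le[of z i] assms by simp
  then show "cmod (a $ i * z $ i) \<le> cmod (a $ i)"
    by (simp add: norm_mult mult_left_le)
qed

lemma norm_square_power_le_1:
  fixes z :: "'a::real_normed_vector"
  assumes "z \<in> ball 0 1"
  shows "((norm z)\<^sup>2) ^ k \<le> 1"
  using assms by (auto intro!: power_le_one)

lemma testfun_L2: "testfun a m \<in> L2_ball"
proof (rule continuous_bounded_L2)
  show "continuous_on unit_ball (testfun a m)"
    unfolding testfun_def by (intro continuous_intros)
  show "cmod (testfun a m z) \<le> (\<Sum>i\<in>UNIV. cmod (a $ i)) * 1" if "z \<in> unit_ball" for z
    unfolding cmod_testfun using that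
    by (intro mult_mono cmod_sum_mult_le norm_square_power_le_1 sum_nonneg) auto
qed

text \<open>At each point of the open ball the squared norm is strictly below 1, so its powers tend
  to 0. A constant dominates, being integrable for a probability measure.\<close>

lemma L2_norm_testfun_tendsto_0:
  fixes a :: "complex ^ 'n"
  shows "(\<lambda>m. L2_norm (testfun a m)) \<longlonglongrightarrow> 0"
proof -
  let ?C = "\<Sum>i\<in>UNIV. cmod (a $ i)"
  have "(\<lambda>m. LINT z|ball_measure. (cmod (testfun a m z))\<^sup>2)
      \<longlonglongrightarrow> (LINT z|(ball_measure :: (complex ^ 'n) measure). 0 :: real)"
  proof (rule integral_dominated_convergence[where w = "\<lambda>_. ?C\<^sup>2"])
    show "(\<lambda>z. (cmod (testfun a m z))\<^sup>2) \<in> borel_measurable ball_measure" for m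
      using testfun_L2[of a m] by (auto simp: L2_ball_def)
    show "AE z in ball_measure. (\<lambda>m. (cmod (testfun a m z))\<^sup>2) \<longlonglongrightarrow> 0"
    proof (rule AE_I2)
      fix z :: "complex ^ 'n" assume "z \<in> space ball_measure"
      then have "(norm z)\<^sup>2 < 1" by (simp add: abs_square_less_1)
      then have "(\<lambda>m. (cmod (\<Sum>i\<in>UNIV. a $ i * z $ i) * ((norm z)\<^sup>2) ^ m)\<^sup>2) \<longlonglongrightarrow>
          (cmod (\<Sum>i\<in>UNIV. a $ i * z $ i) * 0)\<^sup>2"
        by (intro tendsto_intros LIMSEQ_realpow_zero) auto
      then show "(\<lambda>m. (cmod (testfun a m z))\<^sup>2) \<longlonglongrightarrow> 0"
        by (simp add: cmod_testfun)
    qed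
    show "AE z in ball_measure. norm ((cmod (testfun a m z))\<^sup>2) \<le> ?C\<^sup>2" for m
    proof (rule AE_I2)
      fix z :: "complex ^ 'n" assume "z \<in> space ball_measure"
      then have "cmod (testfun a m z) \<le> ?C * 1"
        unfolding cmod_testfun
        by (intro mult_mono cmod_sum_mult_le norm_square_power_le_1 sum_nonneg) auto
      then show "norm ((cmod (testfun a m z))\<^sup>2) \<le> ?C\<^sup>2"
        by (simp add: power_mono)
    qed
  qed auto
  then show ?thesis
    unfolding L2_norm_def using tendsto_real_sqrt by fastforce
qed

lemma antiholomorphic_derivation_testfun_L2:
  "antiholomorphic_derivation a (testfun a (Suc k)) \<in> L2_ball"
proof (rule continuous_bounded_L2)
  let ?C = "\<Sum>i\<in>UNIV. cmod (a $ i)"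
  show "continuous_on unit_ball (antiholomorphic_derivation a (testfun a (Suc k)))"
    unfolding antiholomorphic_derivation_testfun by (intro continuous_intros)
  show "cmod (antiholomorphic_derivation a (testfun a (Suc k)) z)
      \<le> (norm a)\<^sup>2 * 1 + (Suc k * 1) * ?C\<^sup>2" if "z \<in> unit_ball" for z
    unfolding antiholomorphic_derivation_testfun norm_of_real using that
    by (subst abs_of_nonneg) (intro add_mono mult_mono cmod_sum_mult_le norm_square_power_le_1
      power_mono add_nonneg_nonneg mult_nonneg_nonneg; simp)+
qed

text \<open>On a cone where the linear form is comparable to the norm, the derivative is of order
  \<open>Suc k\<close> in a shell at the boundary of width of order 1 / \<open>Suc k\<close>. The
  two factors cancel, so \<open>\<delta>\<close> is uniform in k.\<close>

lemma integral_antiholomorphic_derivation_testfun_ge: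
  fixes a :: "complex ^ 'n"
  assumes "a $ i \<noteq> 0"
  shows "\<exists>\<delta>>0. \<forall>k. \<delta> \<le> cmod (LINT z|ball_measure. antiholomorphic_derivation a (testfun a (Suc k)) z)"
proof -
  let ?s = "\<lambda>z. \<Sum>i\<in>UNIV. a $ i * z $ i"
  \<comment> \<open>Half of \<open>cmod (a $ i)\<close> makes the inequality defining
    \<open>C\<close> strict on the nonzero points of the i-th axis. The open cone thus meets the
    ball, at \<open>axis i (1/2)\<close> for instance.\<close>
  define c where "c = cmod (a $ i) / 2"
  define C where "C = {z :: complex ^ 'n. c * norm z < cmod (?s z)}"
  define V where "V = measure lebesgue (unit_ball :: (complex ^ 'n) set)"
  define M where "M = measure lebesgue (C \<inter> unit_ball)"
  have c: "c > 0" using assms by (simp add: c_def)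
  have V: "V > 0" unfolding V_def by (rule measure_unit_ball_pos)
  have "open C" unfolding C_def by (intro open_Collect_less continuous_intros)
  then have C: "C \<in> sets lebesgue" by simp
  have "norm (axis i (1/2) :: complex ^ 'n) = 1/2"
    by (simp add: norm_eq_sqrt_inner inner_axis_axis inner_complex_def real_sqrt_divide)
  then have "axis i (1/2) \<in> C \<inter> unit_ball"
    using assms by (simp add: C_def c_def sum_mult_axis norm_mult)
  then have "\<not> negligible (C \<inter> unit_ball)"
    using \<open>open C\<close> by (intro open_not_negligible) auto
  moreover have "C \<inter> unit_ball \<in> lmeasurable"
    using C fmeasurable_Int_fmeasurable[of "ball 0 1" lebesgue C] by (simp add: Int_commute)
  ultimately have M: "M > 0"
    by (simp add: M_def negligible_iff_measure zero_less_measure_iff)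
  have cone: "t *\<^sub>R x \<in> C" if "0 < t" "x \<in> C" for t x
  proof -
    have "?s (t *\<^sub>R x) = t *\<^sub>R ?s x" by (simp add: scaleR_sum_right)
    then show ?thesis using that by (simp add: C_def)
  qed
  \<comment> \<open>The 8 is 4 times 2: \<open>Suc k * (1 - r)\<close> equals 1/4, and the power of
    the norm is at least 1/2 on the shell.\<close>
  define \<delta> where "\<delta> = c\<^sup>2 * M / (8 * V)"
  have "\<delta> \<le> cmod (LINT z|ball_measure. antiholomorphic_derivation a (testfun a (Suc k)) z)" for k
  proof -
    \<comment> \<open>By Bernoulli the power \<open>2 * Suc k\<close> of r is at least 1 - 2/4 =
      1/2, while the shell keeps a width proportional to 1 / \<open>Suc k\<close>.\<close>
    define r where "r = 1 - 1 / (4 * real (Suc k))"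
    define S where "S = C \<inter> unit_ball - ball 0 r"
    define g where "g z = (norm a)\<^sup>2 * ((norm z)\<^sup>2) ^ Suc k +
       Suc k * ((norm z)\<^sup>2) ^ k * (cmod (?s z))\<^sup>2" for z
    have r: "0 < r" "r < 1" by (auto simp: r_def field_simps)
    have r2: "1/2 \<le> (r\<^sup>2) ^ Suc k"
    proof -
      have "1 + real (2 * Suc k) * (r - 1) \<le> (1 + (r - 1)) ^ (2 * Suc k)"
        using r by (intro Bernoulli_inequality) simp
      moreover have "real (2 * Suc k) * (r - 1) = - 1/2" by (simp add: r_def field_simps)
      ultimately show ?thesis by (simp only: power_mult) simp
    qed
    have S_lebesgue: "S \<in> sets lebesgue"
      using sets.Diff[OF sets.Int[OF C], of unit_ball "ball 0 r"] by (simp add: S_def)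
    then have S: "S \<in> sets ball_measure"
      unfolding sets_ball_measure by (subst sets_restrict_space_iff) (auto simp: S_def)
    \<comment> \<open>The dimension is at least 1, so the shell occupies at least the fraction
      \<open>1 - r\<close> of the cone, a bound free of the dimension.\<close>
    have "r ^ DIM(complex ^ 'n) \<le> r ^ 1"
      using r by (intro power_decreasing) (auto simp: Suc_leI)
    then have "(1 - r) * M \<le> (1 - r ^ DIM(complex ^ 'n)) * M"
      using M by (intro mult_right_mono) auto
    also have "\<dots> = measure lebesgue S"
      using r measure_cone_diff_ball[OF C cone, of r] by (simp add: S_def M_def)
    finally have "(1 - r) * M / V \<le> measure lebesgue S / V"
      using V by (intro divide_right_mono) auto
    also have "\<dots> = measure ball_measure S"
      unfolding V_def using S_lebesgue by (subst measure_ball_measure) (auto simp: S_def)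
    finally have prob_S: "(1 - r) * M / V \<le> measure ball_measure S" .
    \<comment> \<open>On \<open>S\<close> the cone inequality supplies one more factor
      \<open>(norm z)\<^sup>2\<close>, raising the exponent from k to \<open>Suc k\<close> as in
      \<open>r2\<close>. Off \<open>S\<close> only \<open>g z \<ge> 0\<close> is asked for.\<close>
    have lower: "Suc k * c\<^sup>2 / 2 * indicator S z \<le> g z" if "z \<in> unit_ball" for z
    proof (cases "z \<in> S")
      case True
      then have z: "r \<le> norm z" "c * norm z \<le> cmod (?s z)" by (auto simp: S_def C_def)
      have "1/2 \<le> ((norm z)\<^sup>2) ^ Suc k"
        using r z by (intro order_trans[OF r2] power_mono) auto
      then have "real (Suc k) * c\<^sup>2 * (1 / 2) \<le> real (Suc k) * c\<^sup>2 * ((norm z)\<^sup>2) ^ Suc k"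
        by (intro mult_left_mono) auto
      also have "\<dots> = Suc k * ((norm z)\<^sup>2) ^ k * (c * norm z)\<^sup>2"
        by (simp add: power_mult_distrib mult_ac)
      also have "\<dots> \<le> Suc k * ((norm z)\<^sup>2) ^ k * (cmod (?s z))\<^sup>2"
        using z c by (intro mult_left_mono power_mono) auto
      also have "\<dots> \<le> g z" unfolding g_def by simp
      finally show ?thesis using True by simp
    qed (auto simp: g_def)
    have Y: "antiholomorphic_derivation a (testfun a (Suc k)) = (\<lambda>z. of_real (g z))"
      by (simp only: fun_eq_iff antiholomorphic_derivation_testfun g_def simp_thms)
    have "integrable ball_measure (\<lambda>z. complex_of_real (g z))"
      using L2_integrable[OF antiholomorphic_derivation_testfun_L2, of a k] Y by simp
    then have g: "integrable ball_measure g"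
      using complex_of_real_integrable_eq by blast
    have "Suc k * (1 - r) = 1/4" by (simp add: r_def field_simps)
    then have "(Suc k * (1 - r)) * (c\<^sup>2 * M / (2 * V)) = \<delta>" by (simp only: \<delta>_def)
    then have "\<delta> = Suc k * c\<^sup>2 / 2 * ((1 - r) * M / V)" by (simp add: mult_ac)
    also have "\<dots> \<le> Suc k * c\<^sup>2 / 2 * measure ball_measure S"
      using prob_S by (intro mult_left_mono) auto
    also have "\<dots> = (LINT z|ball_measure. Suc k * c\<^sup>2 / 2 * indicator S z)"
      using S sets.sets_into_space[OF S] by (simp add: Int_absorb2)
    also have "\<dots> \<le> (LINT z|ball_measure. g z)"
    proof (rule integral_mono)
      show "integrable ball_measure (\<lambda>z. Suc k * c\<^sup>2 / 2 * indicator S z)"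
        using S by (intro integrable_mult_right) (simp add: less_top[symmetric])
    qed (use g lower in auto)
    also have "\<dots> \<le> cmod (LINT z|ball_measure. of_real (g z))"
      by (simp only: integral_complex_of_real norm_of_real abs_ge_self)
    finally show ?thesis unfolding Y .
  qed
  moreover have "\<delta> > 0" using c M V by (simp add: \<delta>_def)
  ultimately show ?thesis by blast
qed

section \<open>Pairing with constants and the contradiction\<close>

lemma const_bergman_space: "(\<lambda>z. c) \<in> bergman_space"
  unfolding bergman_space_def holomorphic_on_ball_def
  by (auto intro!: continuous_bounded_L2[of _ "cmod c"] exI[of _ "\<lambda>_. 0"])

text \<open>The constant 1 lies in the Bergman space, so \<open>f - P f\<close> is orthogonal to it,
  that is, has integral zero.\<close>

lemma integral_bergman_projection:
  assumes "bergman_projection P" "f \<in> L2_ball"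
  shows "(LINT z|ball_measure. P f z) = (LINT z|ball_measure. f z)"
proof -
  have "P f \<in> bergman_space" "L2_inner (\<lambda>z. f z - P f z) (\<lambda>z. 1) = 0"
    using assms const_bergman_space[of 1] unfolding bergman_projection_def by blast+
  then show ?thesis
    using L2_integrable[OF assms(2)] L2_integrable[of "P f"]
    by (simp add: L2_inner_def bergman_space_def)
qed

theorem corollary7p3p2:
  fixes a :: "complex ^ 'n"
    and P :: "(complex ^ 'n \<Rightarrow> complex) \<Rightarrow> (complex ^ 'n \<Rightarrow> complex)"
  assumes "\<exists>i. a $ i \<noteq> 0"
    and "bergman_projection P"
  shows "\<not> (\<exists>T. bounded_L2_operator T \<and>
           (\<forall>f\<in>polynomials_on_ball. AE z in ball_measure.
              T f z = commutator (antiholomorphic_derivation a) P f z))"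
proof
  let ?Y = "antiholomorphic_derivation a"
  assume "\<exists>T. bounded_L2_operator T \<and>
           (\<forall>f\<in>polynomials_on_ball. AE z in ball_measure. T f z = commutator ?Y P f z)"
  then obtain T K where T_L2: "\<And>f. f \<in> L2_ball \<Longrightarrow> T f \<in> L2_ball"
    and K: "\<And>f. f \<in> L2_ball \<Longrightarrow> L2_norm (T f) \<le> K * L2_norm f"
    and T: "\<And>f. f \<in> polynomials_on_ball \<Longrightarrow> AE z in ball_measure. T f z = commutator ?Y P f z"
    unfolding bounded_L2_operator_def by blast
  obtain \<delta> where \<delta>: "\<delta> > 0" "\<And>k. \<delta> \<le> cmod (LINT z|ball_measure. ?Y (testfun a (Suc k)) z)"
    using assms(1) integral_antiholomorphic_derivation_testfun_ge by blast
  have bound: "\<delta> \<le> K * L2_norm (testfun a (Suc k))" for k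
  proof -
    let ?f = "testfun a (Suc k)"
    have P_L2: "P (?Y ?f) \<in> L2_ball" and hol: "holomorphic_on_ball (P ?f)"
      using assms(2) testfun_L2[of a "Suc k"] antiholomorphic_derivation_testfun_L2[of a k]
      unfolding bergman_projection_def bergman_space_def by blast+
    \<comment> \<open>The term \<open>?Y (P ?f)\<close> of the commutator vanishes at every point of
      the ball, to which \<open>AE_space\<close> restricts z.\<close>
    have "AE z in ball_measure. T ?f z = - P (?Y ?f) z"
      using T[OF testfun_polynomial, of a "Suc k"] AE_space
      by eventually_elim (simp add: commutator_def antiholomorphic_derivation_holomorphic[OF hol])
    then have "(LINT z|ball_measure. T ?f z) = (LINT z|ball_measure. - P (?Y ?f) z)"
      using L2_integrable[OF T_L2[OF testfun_L2]] L2_integrable[OF P_L2]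
      by (intro integral_cong_AE) auto
    also have "\<dots> = - (LINT z|ball_measure. ?Y ?f z)"
      using integral_bergman_projection[OF assms(2) antiholomorphic_derivation_testfun_L2] by simp
    finally have "\<delta> \<le> cmod (LINT z|ball_measure. T ?f z)"
      using \<delta>(2)[of k] by simp
    also have "\<dots> \<le> K * L2_norm ?f"
      using norm_integral_le_L2_norm[OF T_L2[OF testfun_L2]] K[OF testfun_L2] by (rule order_trans)
    finally show ?thesis .
  qed
  \<comment> \<open>The lower bound \<open>\<delta>\<close> does not depend on k, so it survives in
    the limit. \<open>LIMSEQ_Suc\<close> accounts for the shifted index.\<close>
  have "(\<lambda>k. K * L2_norm (testfun a (Suc k))) \<longlonglongrightarrow> K * 0"
    by (intro tendsto_intros LIMSEQ_Suc L2_norm_testfun_tendsto_0)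
  then have "\<delta> \<le> K * 0"
    using bound by (intro LIMSEQ_le_const) auto
  then show False using \<delta>(1) by simp
qed

end
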